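(* Let $L$ be a finite loop of order $n$, let $d\ge 2$ be an integer, and let $(\psi,\phi)\in\mathcal{C}^2_\delta(L)$. If the matrix $M_\phi$ is Hadamard, then the $d$-dimensional array $H_{\psi,\phi,d}$ is proper Hadamard.
   Context: A loop is a set $L$ with a binary operation (written by juxtaposition, not necessarily associative) having an identity element $e$ and such that for all $a,b\in L$ the equations $ax=b$ and $ya=b$ have unique solutions $x,y\in L$. $\mathcal{C}^2(L)$ is the set of all functions $L\times L\to\mathbb{Z}_2$ ($2$-cochains). $\mathcal{C}^2_\delta(L)$ is the set of $\delta$-compatible pairs, i.e. pairs $(\psi,\phi)\in\mathcal{C}^2(L)\times\mathcal{C}^2(L)$ with $\psi(a,b)+\phi(ab,c)=\phi(a,bc)+\psi(b,c)$ for all $a,b,c\in L$. For $f\in\mathcal{C}^2(L)$, $M_f$ is the $n\times n$ matrix indexed by $L$ with $M_f[a,b]:=(-1)^{f(a,b)}$. For $d\geq 2$, the array $H_{\psi,\phi,d}:L^d\to\{\pm1\}$ is \[H_{\psi,\phi,d}[a_1,\ldots,a_d]:=\left(\prod_{i=2}^{d-1} M_\psi[p_{i-1},a_i]\right)\cdot M_{\phi}[p_{d-1},a_d],\] where $p_1:=a_1$ and $p_i:=p_{i-1}a_i$ for $2\le i<d$ (an empty product is $1$). An $n\times n$ matrix $M$ with entries in $\{-1,1\}$ is Hadamard if $MM^T=nI_n$. A $d$-dimensional array $H:L^d\to\{\pm1\}$ is proper Hadamard if for all distinct $k,l\in\{1,\ldots,d\}$, all $a,b\in L$ and every choice of the remaining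 coordinates $a_i\in L$ ($i\ne k,l$), one has $\sum_{j\in L}H[\mathbf{x}^{a,j}]\,H[\mathbf{x}^{b,j}]=n\cdot\delta_{ab}$, where $\mathbf{x}^{s,j}\in L^d$ denotes the tuple with $k$-th coordinate $s$, $l$-th coordinate $j$ and $i$-th coordinate $a_i$ for $i\neq k,l$, and $\delta_{ab}$ is the Kronecker delta. *)

theory Defs
  imports "HOL-Algebra.Group" "HOL-Library.Z2" "HOL-Library.FuncSet"
begin

text \<open>Only the signature (carrier, multiplication, identity) is taken from the record of
  HOL-Algebra; associativity is not assumed.\<close>

locale loop =
  fixes L :: "('a, 'm) monoid_scheme" (structure)
  assumes m_closed: "\<lbrakk>a \<in> carrier L; b \<in> carrier L\<rbrakk> \<Longrightarrow> a \<otimes> b \<in> carrier L"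
    and one_closed: "\<one> \<in> carrier L"
    and l_one: "a \<in> carrier L \<Longrightarrow> \<one> \<otimes> a = a"
    and r_one: "a \<in> carrier L \<Longrightarrow> a \<otimes> \<one> = a"
    and ex1_right_solution:
      "\<lbrakk>a \<in> carrier L; b \<in> carrier L\<rbrakk> \<Longrightarrow> \<exists>!x. x \<in> carrier L \<and> a \<otimes> x = b"
    and ex1_left_solution:
      "\<lbrakk>a \<in> carrier L; b \<in> carrier L\<rbrakk> \<Longrightarrow> \<exists>!y. y \<in> carrier L \<and> y \<otimes> a = b"

text \<open>A 2-cochain is a curried total function into the field with two elements; its values
  outside the carrier are arbitrary and play no role below.\<close>

type_synonym 'a cochain2 = "'a \<Rightarrow> 'a \<Rightarrow> bit"

definition delta_compatible :: "('a, 'm) monoid_scheme \<Rightarrow> ('a cochain2 \<times> 'a cochain2) set" where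
  "delta_compatible L = {(\<psi>, \<phi>).
     \<forall>a \<in> carrier L. \<forall>b \<in> carrier L. \<forall>c \<in> carrier L.
       \<psi> a b + \<phi> (a \<otimes>\<^bsub>L\<^esub> b) c = \<phi> a (b \<otimes>\<^bsub>L\<^esub> c) + \<psi> b c}"

definition cochain_matrix :: "'a cochain2 \<Rightarrow> 'a \<Rightarrow> 'a \<Rightarrow> int" where
  "cochain_matrix f a b = (-1) ^ (of_bit (f a b) :: nat)"

text \<open>Square matrices with rows and columns indexed by a finite set \<open>S\<close> are functions of two
  arguments, considered on \<open>S\<close> only.\<close>

definition matrix_mult_on ::
    "'i set \<Rightarrow> ('i \<Rightarrow> 'i \<Rightarrow> int) \<Rightarrow> ('i \<Rightarrow> 'i \<Rightarrow> int) \<Rightarrow> 'i \<Rightarrow> 'i \<Rightarrow> int" where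
  "matrix_mult_on S A B a b = (\<Sum>j\<in>S. A a j * B j b)"

definition hadamard_matrix_on :: "'i set \<Rightarrow> ('i \<Rightarrow> 'i \<Rightarrow> int) \<Rightarrow> bool" where
  "hadamard_matrix_on S M \<longleftrightarrow>
     (\<forall>a\<in>S. \<forall>b\<in>S. M a b \<in> {-1, 1}) \<and>
     (\<forall>a\<in>S. \<forall>b\<in>S.
        matrix_mult_on S M (\<lambda>i j. M j i) a b = int (card S) * of_bool (a = b))"

text \<open>A \<open>d\<close>-tuple over \<open>S\<close> is a function in \<open>{1..d} \<rightarrow>\<^sub>E S\<close>. The array condition overwrites
  coordinates \<open>k\<close> and \<open>l\<close> of a full tuple \<open>x\<close>, so only the remaining coordinates of \<open>x\<close> matter.\<close>

definition proper_hadamard_on :: "'i set \<Rightarrow> nat \<Rightarrow> ((nat \<Rightarrow> 'i) \<Rightarrow> int) \<Rightarrow> bool" where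
  "proper_hadamard_on S d H \<longleftrightarrow>
     (\<forall>x \<in> {1..d} \<rightarrow>\<^sub>E S. H x \<in> {-1, 1}) \<and>
     (\<forall>k \<in> {1..d}. \<forall>l \<in> {1..d}. k \<noteq> l \<longrightarrow>
        (\<forall>a\<in>S. \<forall>b\<in>S. \<forall>x \<in> {1..d} \<rightarrow>\<^sub>E S.
           (\<Sum>j\<in>S. H (x(k := a, l := j)) * H (x(k := b, l := j)))
             = int (card S) * of_bool (a = b)))"

text \<open>Left-normed products \<open>p\<^sub>i = (\<dots>(a\<^sub>1 a\<^sub>2)\<dots>)a\<^sub>i\<close>; the index 0 is not used.\<close>

fun left_prod :: "('a, 'm) monoid_scheme \<Rightarrow> (nat \<Rightarrow> 'a) \<Rightarrow> nat \<Rightarrow> 'a" where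
  "left_prod L a 0 = undefined"
| "left_prod L a (Suc 0) = a 1"
| "left_prod L a (Suc (Suc i)) = left_prod L a (Suc i) \<otimes>\<^bsub>L\<^esub> a (Suc (Suc i))"

definition cochain_array ::
    "('a, 'm) monoid_scheme \<Rightarrow> 'a cochain2 \<Rightarrow> 'a cochain2 \<Rightarrow> nat \<Rightarrow> (nat \<Rightarrow> 'a) \<Rightarrow> int" where
  "cochain_array L \<psi> \<phi> d a =
     (\<Prod>i = 2..d - 1. cochain_matrix \<psi> (left_prod L a (i - 1)) (a i))
       * cochain_matrix \<phi> (left_prod L a (d - 1)) (a d)"

end

theory Submission
  imports Defs
begin

text \<open>Let \<open>p\<^sub>i\<close> be the left-normed product of the first \<open>i\<close> coordinates and
  \<open>q\<^sub>m = a\<^sub>m(a\<^sub>m\<^sub>+\<^sub>1(\<dots>a\<^sub>d))\<close>. Applying compatibility from the right end of the defining product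
  inwards, the array value becomes, for every \<open>2 \<le> m \<le> d\<close>, a sign depending only on the
  coordinates below \<open>m\<close>, times a sign depending only on the coordinates from \<open>m\<close> on, times
  \<open>M\<^sub>\<phi>[p\<^sub>m\<^sub>-\<^sub>1, q\<^sub>m]\<close>. Take \<open>m = max k l\<close>. If the summation coordinate is \<open>m\<close>, the sum is up to sign
  the inner product of two rows of \<open>M\<^sub>\<phi>\<close>; if it is the smaller one, the sum is up to sign the
  inner product of two columns. In both cases cancellation in the loop makes the two lines
  distinct and the summation index run over the whole loop.\<close>

text \<open>The last argument counts the factors after \<open>a m\<close>, so
  \<open>right_prod L a m (d - m)\<close> is \<open>q\<^sub>m\<close>.\<close>

fun right_prod :: "('a, 'm) monoid_scheme \<Rightarrow> (nat \<Rightarrow> 'a) \<Rightarrow> nat \<Rightarrow> nat \<Rightarrow> 'a" where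
  "right_prod L a m 0 = a m"
| "right_prod L a m (Suc i) = a m \<otimes>\<^bsub>L\<^esub> right_prod L a (Suc m) i"

definition prefix_sign :: "('a, 'm) monoid_scheme \<Rightarrow> 'a cochain2 \<Rightarrow> nat \<Rightarrow> (nat \<Rightarrow> 'a) \<Rightarrow> int" where
  "prefix_sign L \<psi> m a = (\<Prod>i = 2..<m. cochain_matrix \<psi> (left_prod L a (i - 1)) (a i))"

text \<open>The factors are the signs
  \<open>M\<^sub>\<psi>[a\<^sub>i, q\<^sub>i\<^sub>+\<^sub>1]\<close> released as parentheses move
  to the right; there are none at \<open>m = d\<close>.\<close>

definition suffix_sign ::
    "('a, 'm) monoid_scheme \<Rightarrow> 'a cochain2 \<Rightarrow> nat \<Rightarrow> nat \<Rightarrow> (nat \<Rightarrow> 'a) \<Rightarrow> int" where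
  "suffix_sign L \<psi> d m a =
     (\<Prod>i = m..<d. cochain_matrix \<psi> (a i) (right_prod L a (Suc i) (d - Suc i)))"

section \<open>Arithmetic of signs\<close>

lemma cochain_matrix_cases: "cochain_matrix f a b = 1 \<or> cochain_matrix f a b = -1"
  by (cases "f a b") (simp_all add: cochain_matrix_def)

lemma cochain_matrix_mult:
  "cochain_matrix f a b * cochain_matrix g c e = (-1) ^ (of_bit (f a b + g c e) :: nat)"
  by (cases "f a b"; cases "g c e") (simp_all add: cochain_matrix_def)

text \<open>The map sending \<open>t\<close> to \<open>(-1)^t\<close> turns addition in the
  two-element field into multiplication of signs, which makes compatibility multiplicative.\<close>

lemma delta_compatible_cochain_matrix:
  assumes "(\<psi>, \<phi>) \<in> delta_compatible L"
    and "a \<in> carrier L" "b \<in> carrier L" "c \<in> carrier L"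
  shows "cochain_matrix \<psi> a b * cochain_matrix \<phi> (a \<otimes>\<^bsub>L\<^esub> b) c
       = cochain_matrix \<psi> b c * cochain_matrix \<phi> a (b \<otimes>\<^bsub>L\<^esub> c)"
  using assms by (simp add: cochain_matrix_mult delta_compatible_def add.commute)

lemma prod_cochain_matrix_square:
  "(\<Prod>i\<in>I. cochain_matrix f (g i) (h i)) * (\<Prod>i\<in>I. cochain_matrix f (g i) (h i)) = 1"
proof -
  have "cochain_matrix f (g i) (h i) * cochain_matrix f (g i) (h i) = 1" for i
    using cochain_matrix_cases[of f "g i" "h i"] by auto
  then show ?thesis by (simp flip: prod.distrib)
qed

lemma prefix_sign_square: "prefix_sign L \<psi> m a * prefix_sign L \<psi> m a = 1"
  unfolding prefix_sign_def by (rule prod_cochain_matrix_square)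

lemma suffix_sign_square: "suffix_sign L \<psi> d m a * suffix_sign L \<psi> d m a = 1"
  unfolding suffix_sign_def by (rule prod_cochain_matrix_square)

lemma prod_pm1: "(\<And>i. i \<in> I \<Longrightarrow> f i = 1 \<or> f i = -1) \<Longrightarrow> prod f I \<in> {-1, 1 :: int}"
proof (induction I rule: infinite_finite_induct)
  case (insert i I)
  then have "f i = 1 \<or> f i = -1" "prod f I \<in> {-1, 1}" by auto
  with insert.hyps show ?case by auto
qed auto

lemma cochain_array_pm1: "cochain_array L \<psi> \<phi> d a \<in> {-1, 1}"
proof -
  have "(\<Prod>i = 2..d - 1. cochain_matrix \<psi> (left_prod L a (i - 1)) (a i)) \<in> {-1, 1}"
    by (intro prod_pm1 cochain_matrix_cases)
  then show ?thesis
    unfolding cochain_array_def using cochain_matrix_cases[of \<phi> "left_prod L a (d - 1)" "a d"]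
    by auto
qed

section \<open>Dependence of products and signs on the coordinates\<close>

lemma left_prod_Suc: "0 < i \<Longrightarrow> left_prod L a (Suc i) = left_prod L a i \<otimes>\<^bsub>L\<^esub> a (Suc i)"
  by (cases i) auto

lemma left_prod_cong:
  assumes "0 < i" and "\<And>j. 1 \<le> j \<Longrightarrow> j \<le> i \<Longrightarrow> a j = b j"
  shows "left_prod L a i = left_prod L b i"
  using assms by (induction i rule: nat_induct_non_zero) (auto simp: left_prod_Suc)

lemma right_prod_cong:
  assumes "\<And>j. m \<le> j \<Longrightarrow> a j = b j"
  shows "right_prod L a m i = right_prod L b m i"
  using assms by (induction i arbitrary: m) auto

lemma prefix_sign_cong:
  assumes "\<And>j. j < m \<Longrightarrow> a j = b j"
  shows "prefix_sign L \<psi> m a = prefix_sign L \<psi> m b"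
  unfolding prefix_sign_def
proof (rule prod.cong)
  fix i assume i: "i \<in> {2..<m}"
  then have "left_prod L a (i - 1) = left_prod L b (i - 1)"
    by (intro left_prod_cong) (auto intro: assms)
  with i show "cochain_matrix \<psi> (left_prod L a (i - 1)) (a i)
      = cochain_matrix \<psi> (left_prod L b (i - 1)) (b i)"
    by (simp add: assms)
qed simp

lemma suffix_sign_cong:
  assumes "\<And>j. m \<le> j \<Longrightarrow> a j = b j"
  shows "suffix_sign L \<psi> d m a = suffix_sign L \<psi> d m b"
  unfolding suffix_sign_def
proof (rule prod.cong)
  fix i assume i: "i \<in> {m..<d}"
  then have "right_prod L a (Suc i) (d - Suc i) = right_prod L b (Suc i) (d - Suc i)"
    by (intro right_prod_cong) (auto intro: assms)
  with i show "cochain_matrix \<psi> (a i) (right_prod L a (Suc i) (d - Suc i))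
      = cochain_matrix \<psi> (b i) (right_prod L b (Suc i) (d - Suc i))"
    by (simp add: assms)
qed simp

section \<open>Cancellation and factorization in a loop\<close>

context loop
begin

lemma l_cancel:
  "\<lbrakk>c \<in> carrier L; a \<in> carrier L; b \<in> carrier L; c \<otimes> a = c \<otimes> b\<rbrakk> \<Longrightarrow> a = b"
  using ex1_right_solution[of c "c \<otimes> b"] m_closed by blast

lemma r_cancel:
  "\<lbrakk>c \<in> carrier L; a \<in> carrier L; b \<in> carrier L; a \<otimes> c = b \<otimes> c\<rbrakk> \<Longrightarrow> a = b"
  using ex1_left_solution[of c "b \<otimes> c"] m_closed by blast

lemma left_prod_closed:
  assumes "0 < i" and "\<And>j. 1 \<le> j \<Longrightarrow> j \<le> i \<Longrightarrow> a j \<in> carrier L"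
  shows "left_prod L a i \<in> carrier L"
  using assms by (induction i rule: nat_induct_non_zero) (auto simp: left_prod_Suc m_closed)

lemma right_prod_closed:
  assumes "\<And>j. m \<le> j \<Longrightarrow> j \<le> m + i \<Longrightarrow> a j \<in> carrier L"
  shows "right_prod L a m i \<in> carrier L"
  using assms by (induction i arbitrary: m) (auto simp: m_closed)

text \<open>At \<open>i = k\<close> the product is \<open>s\<close> itself or a fixed element times
  \<open>s\<close>, so left cancellation applies. Each later step multiplies by a fixed coordinate
  on the right, which right cancellation undoes.\<close>

lemma left_prod_upd_inj:
  assumes "1 \<le> k" "k \<le> i"
    and "\<And>j. 1 \<le> j \<Longrightarrow> j \<le> i \<Longrightarrow> x j \<in> carrier L"
  shows "inj_on (\<lambda>s. left_prod L (x(k := s)) i) (carrier L)"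
  using assms(2,3)
proof (induction i rule: dec_induct)
  case base
  show ?case
  proof (cases "k = 1")
    case True
    then show ?thesis by (simp add: inj_on_def)
  next
    case False
    with assms(1) obtain i where k: "k = Suc i" "0 < i" by (cases k) auto
    have "left_prod L (x(k := s)) i = left_prod L x i" for s
      using k by (intro left_prod_cong) auto
    then have "left_prod L (x(k := s)) k = left_prod L x i \<otimes> s" for s
      using k left_prod_Suc[of i L "x(k := s)"] by simp
    moreover have "left_prod L x i \<in> carrier L"
      using k base by (intro left_prod_closed) auto
    ultimately show ?thesis
      by (auto simp only: intro!: inj_onI intro: l_cancel)
  qed
next
  case (step i)
  have closed: "left_prod L (x(k := s)) i \<in> carrier L" if "s \<in> carrier L" for s
    using assms(1) step that by (intro left_prod_closed) auto
  show ?case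
  proof (rule inj_onI)
    fix s t assume st: "s \<in> carrier L" "t \<in> carrier L"
      and eq: "left_prod L (x(k := s)) (Suc i) = left_prod L (x(k := t)) (Suc i)"
    have "left_prod L (x(k := s)) i = left_prod L (x(k := t)) i"
      using eq step assms(1) st by (auto simp: left_prod_Suc intro: r_cancel closed)
    moreover have "inj_on (\<lambda>s. left_prod L (x(k := s)) i) (carrier L)"
      by (rule step.IH) (use step.prems in auto)
    ultimately show "s = t"
      using st by (auto dest: inj_onD)
  qed
qed

text \<open>Only the first factor involves \<open>s\<close>; the remaining product is a fixed
  element and cancels on the right.\<close>

lemma right_prod_upd_inj:
  assumes "\<And>j. m < j \<Longrightarrow> j \<le> m + i \<Longrightarrow> x j \<in> carrier L"
  shows "inj_on (\<lambda>s. right_prod L (x(m := s)) m i) (carrier L)"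
proof (cases i)
  case 0
  then show ?thesis by (simp add: inj_on_def)
next
  case (Suc i')
  have "right_prod L (x(m := s)) (Suc m) i' = right_prod L x (Suc m) i'" for s
    by (intro right_prod_cong) auto
  moreover have "right_prod L x (Suc m) i' \<in> carrier L"
    using assms Suc by (intro right_prod_closed) auto
  ultimately show ?thesis
    using Suc by (auto simp: inj_on_def intro: r_cancel)
qed

text \<open>Downward induction from \<open>m = d\<close>, where the claim is the definition. Passing
  from \<open>Suc m\<close> to \<open>m\<close> applies compatibility to
  \<open>p\<^sub>m\<^sub>-\<^sub>1\<close>, \<open>a\<^sub>m\<close>,
  \<open>q\<^sub>m\<^sub>+\<^sub>1\<close>: the last prefix sign is traded for a new first suffix
  sign.\<close>

lemma cochain_array_factor:
  assumes "(\<psi>, \<phi>) \<in> delta_compatible L"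
    and "2 \<le> m" "m \<le> d"
    and "\<And>j. 1 \<le> j \<Longrightarrow> j \<le> d \<Longrightarrow> a j \<in> carrier L"
  shows "cochain_array L \<psi> \<phi> d a = prefix_sign L \<psi> m a * suffix_sign L \<psi> d m a
           * cochain_matrix \<phi> (left_prod L a (m - 1)) (right_prod L a m (d - m))"
  using assms(3,2)
proof (induction m rule: inc_induct)
  case base
  then have "{2..d - 1} = {2..<d}" by auto
  then show ?case
    by (simp add: cochain_array_def prefix_sign_def suffix_sign_def)
next
  case (step m)
  define p where "p = left_prod L a (m - 1)"
  define q where "q = right_prod L a (Suc m) (d - Suc m)"
  have p: "p \<in> carrier L"
    unfolding p_def using step assms(4) by (intro left_prod_closed) auto
  have q: "q \<in> carrier L"
    unfolding q_def using step assms(4) by (intro right_prod_closed) auto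
  have am: "a m \<in> carrier L"
    using step assms(4) by auto
  have pm: "left_prod L a m = p \<otimes> a m"
    using step left_prod_Suc[of "m - 1" L a] by (simp add: p_def)
  have "d - m = Suc (d - Suc m)"
    using step by simp
  then have qm: "right_prod L a m (d - m) = a m \<otimes> q"
    by (simp add: q_def)
  have pre: "prefix_sign L \<psi> (Suc m) a = prefix_sign L \<psi> m a * cochain_matrix \<psi> p (a m)"
    using step by (simp add: prefix_sign_def p_def)
  have suf: "suffix_sign L \<psi> d m a = cochain_matrix \<psi> (a m) q * suffix_sign L \<psi> d (Suc m) a"
    using step by (simp add: suffix_sign_def q_def prod.atLeast_Suc_lessThan)
  have "cochain_array L \<psi> \<phi> d a = prefix_sign L \<psi> (Suc m) a * suffix_sign L \<psi> d (Suc m) a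
          * cochain_matrix \<phi> (left_prod L a m) q"
    using step by (simp add: q_def)
  also have "\<dots> = prefix_sign L \<psi> m a * suffix_sign L \<psi> d (Suc m) a
                * (cochain_matrix \<psi> p (a m) * cochain_matrix \<phi> (p \<otimes> a m) q)"
    by (simp add: pre pm mult_ac)
  also have "\<dots> = prefix_sign L \<psi> m a * suffix_sign L \<psi> d m a * cochain_matrix \<phi> p (a m \<otimes> q)"
    by (simp add: delta_compatible_cochain_matrix[OF assms(1) p am q] suf mult_ac)
  finally show ?case by (simp add: p_def qm)
qed

end

text \<open>With \<open>G = M\<^sup>T M\<close> and \<open>n = |S|\<close>, the trace of \<open>G\<^sup>2\<close> equals that of \<open>(M M\<^sup>T)\<^sup>2\<close>, which is
  \<open>n\<^sup>3\<close>. The \<open>n\<close> diagonal entries of \<open>G\<close> equal \<open>n\<close> and account for all of it, so the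
  off-diagonal entries vanish.\<close>

lemma hadamard_matrix_on_columns:
  assumes fin: "finite S" and had: "hadamard_matrix_on S M"
    and "b \<in> S" "c \<in> S" "b \<noteq> c"
  shows "(\<Sum>a\<in>S. M a b * M a c) = 0"
proof -
  let ?n = "int (card S)"
  define G where "G = (\<lambda>b c. \<Sum>a\<in>S. M a b * M a c)"
  have rows: "(\<Sum>j\<in>S. M a j * M a' j) = ?n * of_bool (a = a')" if "a \<in> S" "a' \<in> S" for a a'
    using had that by (simp add: hadamard_matrix_on_def matrix_mult_on_def)
  have diag: "G b b = ?n" if "b \<in> S" for b
  proof -
    have "M a b * M a b = 1" if "a \<in> S" for a
      using had \<open>b \<in> S\<close> that by (force simp: hadamard_matrix_on_def)
    then show ?thesis by (simp add: G_def)
  qed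
  have "(\<Sum>b\<in>S. \<Sum>c\<in>S. G b c * G b c)
      = (\<Sum>b\<in>S. \<Sum>c\<in>S. \<Sum>a\<in>S. \<Sum>a'\<in>S. (M a b * M a' b) * (M a c * M a' c))"
    unfolding G_def sum_product by (simp add: mult_ac)
  \<comment> \<open>The interchanges bring the row indices \<open>a\<close> and \<open>a'\<close>
    outside, so that the inner double sum becomes a product of two row inner products.\<close>
  also have "\<dots> = (\<Sum>b\<in>S. \<Sum>a\<in>S. \<Sum>c\<in>S. \<Sum>a'\<in>S. (M a b * M a' b) * (M a c * M a' c))"
    by (intro sum.cong refl sum.swap)
  also have "\<dots> = (\<Sum>b\<in>S. \<Sum>a\<in>S. \<Sum>a'\<in>S. \<Sum>c\<in>S. (M a b * M a' b) * (M a c * M a' c))"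
    by (intro sum.cong refl sum.swap)
  also have "\<dots> = (\<Sum>a\<in>S. \<Sum>b\<in>S. \<Sum>a'\<in>S. \<Sum>c\<in>S. (M a b * M a' b) * (M a c * M a' c))"
    by (rule sum.swap)
  also have "\<dots> = (\<Sum>a\<in>S. \<Sum>a'\<in>S. \<Sum>b\<in>S. \<Sum>c\<in>S. (M a b * M a' b) * (M a c * M a' c))"
    by (intro sum.cong refl sum.swap)
  also have "\<dots> = (\<Sum>a\<in>S. \<Sum>a'\<in>S. (\<Sum>b\<in>S. M a b * M a' b) * (\<Sum>c\<in>S. M a c * M a' c))"
    by (simp add: sum_product)
  also have "\<dots> = (\<Sum>a\<in>S. \<Sum>a'\<in>S. if a = a' then ?n * ?n else 0)"
    by (intro sum.cong refl) (simp add: rows)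
  also have "\<dots> = (\<Sum>b\<in>S. G b b * G b b)"
    using fin by (simp add: diag)
  finally have total: "(\<Sum>b\<in>S. \<Sum>c\<in>S. G b c * G b c) = (\<Sum>b\<in>S. G b b * G b b)" .
  have "(\<Sum>c\<in>S. G b c * G b c) = G b b * G b b + (\<Sum>c\<in>S - {b}. G b c * G b c)" if "b \<in> S" for b
    using fin that by (rule sum.remove)
  then have "(\<Sum>b\<in>S. \<Sum>c\<in>S. G b c * G b c)
      = (\<Sum>b\<in>S. G b b * G b b) + (\<Sum>b\<in>S. \<Sum>c\<in>S - {b}. G b c * G b c)"
    by (simp add: sum.distrib)
  with total have "(\<Sum>b\<in>S. \<Sum>c\<in>S - {b}. G b c * G b c) = 0"
    by simp
  \<comment> \<open>Nonnegative terms with sum zero all vanish: first the terms of the outer sum,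
    then those of the inner one.\<close>
  then have "(\<Sum>c\<in>S - {b}. G b c * G b c) = 0"
    using fin \<open>b \<in> S\<close> by (subst (asm) sum_nonneg_eq_0_iff) (auto intro: sum_nonneg)
  then have "G b c * G b c = 0"
    using fin assms(4,5) by (subst (asm) sum_nonneg_eq_0_iff) auto
  then show ?thesis by (simp add: G_def)
qed

text \<open>An injective self-map of a finite set is a permutation, so injectivity in one coordinate
  is all that reindexing requires.\<close>

lemma sum_reindex_inj_endo:
  assumes "finite S" "f ` S \<subseteq> S" "inj_on f S"
  shows "(\<Sum>j\<in>S. g (f j)) = sum g S"
  using assms by (intro sum.reindex_bij_betw) (simp add: bij_betw_def endo_inj_surj)

section \<open>Hadamard property of the array\<close>

theorem corollary17:
  fixes L :: "('a, 'm) monoid_scheme"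
    and \<psi> \<phi> :: "'a cochain2"
    and n d :: nat
  assumes "loop L"
    and "finite (carrier L)"
    and "card (carrier L) = n"
    and "d \<ge> 2"
    and "(\<psi>, \<phi>) \<in> delta_compatible L"
    and "hadamard_matrix_on (carrier L) (cochain_matrix \<phi>)"
  shows "proper_hadamard_on (carrier L) d (cochain_array L \<psi> \<phi> d)"
  unfolding proper_hadamard_on_def
proof (intro conjI ballI impI)
  fix x show "cochain_array L \<psi> \<phi> d x \<in> {-1, 1}" by (rule cochain_array_pm1)
next
  interpret loop L by fact
  let ?S = "carrier L" and ?H = "cochain_array L \<psi> \<phi> d" and ?M = "cochain_matrix \<phi>"
  fix k l a b x
  assume kl: "k \<in> {1..d}" "l \<in> {1..d}" "k \<noteq> l" and ab: "a \<in> ?S" "b \<in> ?S"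
    and x: "x \<in> {1..d} \<rightarrow>\<^sub>E ?S"
  define y where "y = (\<lambda>s j. x(k := s, l := j))"
  have y_closed: "y s j i \<in> ?S" if "s \<in> ?S" "j \<in> ?S" "1 \<le> i" "i \<le> d" for s j i
    using that x by (auto simp: y_def PiE_iff)
  \<comment> \<open>Makes the update at \<open>k\<close> the outermost one, as the injectivity
    lemmas expect.\<close>
  have y_swap: "y s j = x(l := j, k := s)" for s j
    using kl by (auto simp: y_def fun_upd_twist)
  have "(\<Sum>j\<in>?S. ?H (y a j) * ?H (y b j)) = int (card ?S) * of_bool (a = b)"
  proof (cases "a = b")
    case True
    have "?H z * ?H z = 1" for z
      using cochain_array_pm1[of L \<psi> \<phi> d z] by auto
    with True show ?thesis by simp
  next
    case False
    \<comment> \<open>Splitting at the larger position puts one varied coordinate into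
      \<open>p\<close> and the other at the head of \<open>q\<close>. Distinct positions from 1 on
      give \<open>2 \<le> m\<close>.\<close>
    define m where "m = max k l"
    have m: "2 \<le> m" "m \<le> d" using kl by (auto simp: m_def)
    define p where "p = (\<lambda>s j. left_prod L (y s j) (m - 1))"
    define q where "q = (\<lambda>s j. right_prod L (y s j) m (d - m))"
    define P where "P = (\<lambda>s j. prefix_sign L \<psi> m (y s j))"
    define K where "K = (\<lambda>s j. suffix_sign L \<psi> d m (y s j))"
    have H: "?H (y s j) = P s j * K s j * ?M (p s j) (q s j)" if "s \<in> ?S" "j \<in> ?S" for s j
      unfolding P_def K_def p_def q_def
      using that m by (intro cochain_array_factor[OF assms(5)] y_closed) auto
    have p_closed: "p s j \<in> ?S" if "s \<in> ?S" "j \<in> ?S" for s j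
      unfolding p_def using that m by (intro left_prod_closed y_closed) auto
    have q_closed: "q s j \<in> ?S" if "s \<in> ?S" "j \<in> ?S" for s j
      unfolding q_def using that m by (intro right_prod_closed y_closed) auto
    have PP: "P s j * P s j = 1" and KK: "K s j * K s j = 1" for s j
      by (simp_all add: P_def K_def prefix_sign_square suffix_sign_square)
    have "(\<Sum>j\<in>?S. ?H (y a j) * ?H (y b j)) = 0"
    proof (cases "k < l")
      case True
      then have [simp]: "m = l" by (simp add: m_def)
      \<comment> \<open>Here \<open>p\<close> and \<open>P\<close> vary only with \<open>s\<close>,
        while \<open>q\<close> and \<open>K\<close> vary only with \<open>j\<close>;
        \<open>a\<close> is a placeholder for the other argument.\<close>
      have p_indep: "p s j = p s a" for s j
        unfolding p_def using True kl by (intro left_prod_cong) (auto simp: y_def)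
      have P_indep: "P s j = P s a" for s j
        unfolding P_def by (intro prefix_sign_cong) (auto simp: y_def)
      have K_indep: "K s j = K a j" for s j
        unfolding K_def using True by (intro suffix_sign_cong) (auto simp: y_def)
      have q_indep: "q s j = q a j" for s j
        unfolding q_def using True by (intro right_prod_cong) (auto simp: y_def)
      have "inj_on (\<lambda>s. left_prod L ((x(l := a))(k := s)) (m - 1)) ?S"
        using True kl x ab by (intro left_prod_upd_inj) (auto simp: PiE_iff)
      then have "p a a \<noteq> p b a"
        using False ab by (auto simp: p_def y_swap dest: inj_onD)
      have q_inj: "inj_on (q a) ?S"
        unfolding q_def y_def \<open>m = l\<close> using x ab kl
        by (intro right_prod_upd_inj) (auto simp: PiE_iff)
      have "?H (y a j) * ?H (y b j) = P a a * P b a * (?M (p a a) (q a j) * ?M (p b a) (q a j))"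
        if "j \<in> ?S" for j
      proof -
        \<comment> \<open>The sign \<open>K a j\<close> occurs twice and cancels; the prefix signs
          are constant in \<open>j\<close> and leave the sum.\<close>
        have "?H (y a j) * ?H (y b j)
            = P a a * P b a * (K a j * K a j) * (?M (p a a) (q a j) * ?M (p b a) (q a j))"
          unfolding H[OF ab(1) that] H[OF ab(2) that]
            p_indep[of _ j] P_indep[of _ j] K_indep[of b j] q_indep[of b j]
          by (simp only: mult_ac)
        then show ?thesis by (simp add: KK)
      qed
      then have "(\<Sum>j\<in>?S. ?H (y a j) * ?H (y b j))
          = P a a * P b a * (\<Sum>j\<in>?S. ?M (p a a) (q a j) * ?M (p b a) (q a j))"
        by (simp add: sum_distrib_left)
      also have "(\<Sum>j\<in>?S. ?M (p a a) (q a j) * ?M (p b a) (q a j))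
          = (\<Sum>i\<in>?S. ?M (p a a) i * ?M (p b a) i)"
        using assms(2) q_closed ab q_inj
        by (intro sum_reindex_inj_endo[where g = "\<lambda>i. ?M (p a a) i * ?M (p b a) i"]) auto
      also have "\<dots> = 0"
        using assms(6) p_closed ab \<open>p a a \<noteq> p b a\<close>
        by (simp add: hadamard_matrix_on_def matrix_mult_on_def)
      finally show ?thesis by simp
    next
      case False
      with kl have "l < k" by auto
      then have [simp]: "m = k" by (simp add: m_def)
      \<comment> \<open>The roles are exchanged: now \<open>p\<close> and \<open>P\<close> vary only
        with \<open>j\<close>, so \<open>P\<close> cancels and the suffix signs are
        constants.\<close>
      have p_indep: "p s j = p a j" for s j
        unfolding p_def using \<open>l < k\<close> kl by (intro left_prod_cong) (auto simp: y_def)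
      have P_indep: "P s j = P a j" for s j
        unfolding P_def by (intro prefix_sign_cong) (auto simp: y_def)
      have K_indep: "K s j = K s a" for s j
        unfolding K_def using \<open>l < k\<close> by (intro suffix_sign_cong) (auto simp: y_def)
      have q_indep: "q s j = q s a" for s j
        unfolding q_def using \<open>l < k\<close> by (intro right_prod_cong) (auto simp: y_def)
      have "inj_on (\<lambda>s. right_prod L ((x(l := a))(k := s)) k (d - m)) ?S"
        using x ab kl by (intro right_prod_upd_inj) (auto simp: PiE_iff)
      then have "q a a \<noteq> q b a"
        using \<open>a \<noteq> b\<close> ab by (auto simp: q_def y_swap dest: inj_onD)
      have p_inj: "inj_on (p a) ?S"
        unfolding p_def y_def using \<open>l < k\<close> kl x ab
        by (intro left_prod_upd_inj) (auto simp: PiE_iff)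
      have "?H (y a j) * ?H (y b j) = K a a * K b a * (?M (p a j) (q a a) * ?M (p a j) (q b a))"
        if "j \<in> ?S" for j
      proof -
        have "?H (y a j) * ?H (y b j)
            = K a a * K b a * (P a j * P a j) * (?M (p a j) (q a a) * ?M (p a j) (q b a))"
          unfolding H[OF ab(1) that] H[OF ab(2) that]
            p_indep[of b j] P_indep[of b j] K_indep[of _ j] q_indep[of _ j]
          by (simp only: mult_ac)
        then show ?thesis by (simp add: PP)
      qed
      then have "(\<Sum>j\<in>?S. ?H (y a j) * ?H (y b j))
          = K a a * K b a * (\<Sum>j\<in>?S. ?M (p a j) (q a a) * ?M (p a j) (q b a))"
        by (simp add: sum_distrib_left)
      also have "(\<Sum>j\<in>?S. ?M (p a j) (q a a) * ?M (p a j) (q b a))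
          = (\<Sum>i\<in>?S. ?M i (q a a) * ?M i (q b a))"
        using assms(2) p_closed ab p_inj
        by (intro sum_reindex_inj_endo[where g = "\<lambda>i. ?M i (q a a) * ?M i (q b a)"]) auto
      also have "\<dots> = 0"
        \<comment> \<open>The sum now runs down two distinct columns, whereas the hypothesis on
          \<open>\<phi>\<close> speaks of rows.\<close>
        using assms(2,6) q_closed ab \<open>q a a \<noteq> q b a\<close> by (intro hadamard_matrix_on_columns) auto
      finally show ?thesis by simp
    qed
    with \<open>a \<noteq> b\<close> show ?thesis by simp
  qed
  then show "(\<Sum>j\<in>?S. ?H (x(k := a, l := j)) * ?H (x(k := b, l := j)))
      = int (card ?S) * of_bool (a = b)"
    by (simp add: y_def)
qed

end
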